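(* Let $A$ and $B$ be Banach algebras and let $\phi:A\to B$ be a dense and relatively spectral morphism. Then $\mathrm{csr}(A)=\mathrm{csr}(B)$.
   Context: Algebras are complex and unital; morphisms are continuous unital algebra homomorphisms; subalgebras contain the unit. $\mathrm{sp}_A(a)$ denotes the spectrum of $a$ in $A$. A morphism $\phi:A\to B$ is dense if $\phi(A)$ is dense in $B$. It is relatively spectral if there is a dense subalgebra $X$ of $A$ with $\mathrm{sp}_B(\phi(x))=\mathrm{sp}_A(x)$ for all $x\in X$. For $n\ge 1$ put $\mathrm{Lg}_n(A)=\{(a_1,\dots,a_n)\in A^n: Aa_1+\dots+Aa_n=A\}$, with the subspace topology from $A^n$. The connected stable rank $\mathrm{csr}(A)$ is the least $n\geq 1$ such that $\mathrm{Lg}_m(A)$ is connected for all $m\ge n$ (and $\infty$ if there is no such $n$). *)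

theory Defs
  imports "HOL-Analysis.Analysis"
begin

(* The class does not extend real_normed_algebra_1: that class would impose norm 1 = 1
   and exclude the zero algebra. *)
class complex_banach_algebra = real_normed_algebra + monoid_mult + banach +
  fixes scaleC :: "complex \<Rightarrow> 'a \<Rightarrow> 'a"  (infixr "*\<^sub>C" 75)
  assumes scaleC_add_right: "c *\<^sub>C (x + y) = c *\<^sub>C x + c *\<^sub>C y"
    and scaleC_add_left: "(c + d) *\<^sub>C x = c *\<^sub>C x + d *\<^sub>C x"
    and scaleC_scaleC: "c *\<^sub>C (d *\<^sub>C x) = (c * d) *\<^sub>C x"
    and scaleC_of_real: "complex_of_real r *\<^sub>C x = r *\<^sub>R x"
    and mult_scaleC_left: "(c *\<^sub>C x) * y = c *\<^sub>C (x * y)"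
    and mult_scaleC_right: "x * (c *\<^sub>C y) = c *\<^sub>C (x * y)"
    and norm_scaleC: "norm (c *\<^sub>C x) = cmod c * norm x"

definition spectrum :: "'a::complex_banach_algebra \<Rightarrow> complex set" where
  "spectrum a = {z. \<not> (\<exists>b. (z *\<^sub>C 1 - a) * b = 1 \<and> b * (z *\<^sub>C 1 - a) = 1)}"

definition subalgebra :: "'a::complex_banach_algebra set \<Rightarrow> bool" where
  "subalgebra X \<longleftrightarrow>
     1 \<in> X \<and>
     (\<forall>x\<in>X. \<forall>y\<in>X. x + y \<in> X) \<and>
     (\<forall>x\<in>X. \<forall>y\<in>X. x * y \<in> X) \<and>
     (\<forall>c. \<forall>x\<in>X. c *\<^sub>C x \<in> X)"

definition morphism ::
  "('a::complex_banach_algebra \<Rightarrow> 'b::complex_banach_algebra) \<Rightarrow> bool" where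
  "morphism \<phi> \<longleftrightarrow>
     continuous_on UNIV \<phi> \<and>
     (\<forall>x y. \<phi> (x + y) = \<phi> x + \<phi> y) \<and>
     (\<forall>c x. \<phi> (c *\<^sub>C x) = c *\<^sub>C \<phi> x) \<and>
     (\<forall>x y. \<phi> (x * y) = \<phi> x * \<phi> y) \<and>
     \<phi> 1 = 1"

definition dense_morphism ::
  "('a::complex_banach_algebra \<Rightarrow> 'b::complex_banach_algebra) \<Rightarrow> bool" where
  "dense_morphism \<phi> \<longleftrightarrow> morphism \<phi> \<and> closure (range \<phi>) = UNIV"

definition relatively_spectral ::
  "('a::complex_banach_algebra \<Rightarrow> 'b::complex_banach_algebra) \<Rightarrow> bool" where
  "relatively_spectral \<phi> \<longleftrightarrow> morphism \<phi> \<and>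
     (\<exists>X. subalgebra X \<and> closure X = UNIV \<and> (\<forall>x\<in>X. spectrum (\<phi> x) = spectrum x))"

(* n-tuples are functions on {1..n}, extended by undefined outside {1..n}. *)
definition Lg :: "nat \<Rightarrow> (nat \<Rightarrow> 'a::complex_banach_algebra) set" where
  "Lg n = {a \<in> {1..n} \<rightarrow>\<^sub>E UNIV. {\<Sum>i\<in>{1..n}. b i * a i | b. True} = UNIV}"

definition connected_Lg :: "'a::complex_banach_algebra itself \<Rightarrow> nat \<Rightarrow> bool" where
  "connected_Lg _ n \<longleftrightarrow>
     connectedin (product_topology (\<lambda>_. euclidean) {1..n}) (Lg n :: (nat \<Rightarrow> 'a) set)"

definition csr :: "'a::complex_banach_algebra itself \<Rightarrow> enat" where
  "csr A = (if \<exists>n\<ge>1. \<forall>m\<ge>n. connected_Lg A m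
            then enat (LEAST n. n \<ge> 1 \<and> (\<forall>m\<ge>n. connected_Lg A m))
            else \<infinity>)"

end

theory Submission
  imports Defs
begin

(* Write X for the dense subalgebra on which phi preserves spectra. A tuple x over X lies in
   Lg_n(A) iff phi(x) lies in Lg_n(B): a left inverse of phi(x) can be approximated by a tuple
   phi(y) with y over X, so that phi(sum y_i x_i) is invertible, and hence so is sum y_i x_i.
   Since Lg_n(B) is open, phi(Lg_n(A)) is a dense subset of it, so connectedness passes from A
   to B. Conversely, if W is a convex open subset of Lg_n(B), then any two tuples over X that
   phi sends into W are joined by a segment inside Lg_n(A); so a separation of Lg_n(A) induces
   one of Lg_n(B). *)

section \<open>Inverses near the unit, and invertibility read off the spectrum\<close>

lemma left_inverse_near_one:
  fixes x :: "'a::complex_banach_algebra"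
  assumes "norm (x - 1) < 1"
  shows "\<exists>y. y * x = 1"
proof -
  \<comment> \<open>a left inverse of x is a fixed point of a contraction\<close>
  have "\<exists>!y\<in>UNIV. y * (1 - x) + 1 = y"
  proof (rule Banach_fix[where c = "norm (x - 1)"])
    show "dist (y * (1 - x) + 1) (z * (1 - x) + 1) \<le> norm (x - 1) * dist y z" for y z
    proof -
      have "dist (y * (1 - x) + 1) (z * (1 - x) + 1) = norm ((y - z) * (1 - x))"
        by (simp add: dist_norm algebra_simps)
      also have "\<dots> \<le> norm (y - z) * norm (1 - x)"
        by (rule norm_mult_ineq)
      finally show ?thesis
        by (simp add: dist_norm norm_minus_commute mult.commute)
    qed
  qed (use assms in \<open>auto simp: complete_UNIV\<close>)
  then obtain y where "y * (1 - x) + 1 = y" by blast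
  then have "y * x = 1" by (simp add: algebra_simps)
  then show ?thesis ..
qed

lemma right_inverse_near_one:
  fixes x :: "'a::complex_banach_algebra"
  assumes "norm (x - 1) < 1"
  shows "\<exists>y. x * y = 1"
proof -
  have "\<exists>!y\<in>UNIV. (1 - x) * y + 1 = y"
  proof (rule Banach_fix[where c = "norm (x - 1)"])
    show "dist ((1 - x) * y + 1) ((1 - x) * z + 1) \<le> norm (x - 1) * dist y z" for y z
    proof -
      have "dist ((1 - x) * y + 1) ((1 - x) * z + 1) = norm ((1 - x) * (y - z))"
        by (simp add: dist_norm algebra_simps)
      also have "\<dots> \<le> norm (1 - x) * norm (y - z)"
        by (rule norm_mult_ineq)
      finally show ?thesis
        by (simp add: dist_norm norm_minus_commute)
    qed
  qed (use assms in \<open>auto simp: complete_UNIV\<close>)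
  then obtain y where "(1 - x) * y + 1 = y" by blast
  then have "x * y = 1" by (simp add: algebra_simps)
  then show ?thesis ..
qed

lemma inverse_near_one:
  fixes x :: "'a::complex_banach_algebra"
  assumes "norm (x - 1) < 1"
  shows "\<exists>y. x * y = 1 \<and> y * x = 1"
proof -
  obtain y z where "y * x = 1" "x * z = 1"
    using left_inverse_near_one[OF assms] right_inverse_near_one[OF assms] by blast
  then have "y = z"
    by (metis mult.assoc mult_1_left mult_1_right)
  with \<open>y * x = 1\<close> \<open>x * z = 1\<close> show ?thesis by blast
qed

lemma scaleC_zero_left: "(0::complex) *\<^sub>C (x::'a::complex_banach_algebra) = 0"
  using scaleC_of_real[of 0 x] by simp

lemma zero_notin_spectrum_iff:
  "0 \<notin> spectrum a \<longleftrightarrow> (\<exists>b. a * b = 1 \<and> b * a = 1)"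
proof -
  \<comment> \<open>At z = 0 the spectrum tests \<open>- a\<close>; the sign is moved over to the
    inverse.\<close>
  have "0 \<notin> spectrum a \<longleftrightarrow> (\<exists>b. a * - b = 1 \<and> - b * a = 1)"
    by (simp add: spectrum_def scaleC_zero_left)
  also have "\<dots> \<longleftrightarrow> (\<exists>b. a * b = 1 \<and> b * a = 1)"
    by (metis minus_minus)
  finally show ?thesis .
qed

section \<open>Tuples that generate the whole algebra as a left ideal\<close>

text \<open>A left ideal that contains the unit is everything: left multiplication by z turns a
  representation of 1 into one of z.\<close>

lemma mem_Lg_iff:
  "a \<in> Lg n \<longleftrightarrow> a \<in> {1..n} \<rightarrow>\<^sub>E UNIV \<and> (\<exists>b. (\<Sum>i\<in>{1..n}. b i * a i) = 1)"
proof -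
  have "{\<Sum>i\<in>{1..n}. b i * a i | b. True} = UNIV"
    if "(\<Sum>i\<in>{1..n}. b i * a i) = 1" for b
  proof -
    have "z = (\<Sum>i\<in>{1..n}. (z * b i) * a i)" for z
      using that by (simp add: mult.assoc flip: sum_distrib_left)
    then have "z \<in> {\<Sum>i\<in>{1..n}. b i * a i | b. True}" for z
      by (intro CollectI exI[of _ "\<lambda>i. z * b i"]) auto
    then show ?thesis by blast
  qed
  moreover have "\<exists>b. (\<Sum>i\<in>{1..n}. b i * a i) = 1"
    if "{\<Sum>i\<in>{1..n}. b i * a i | b. True} = UNIV"
    using that by (smt (verit, best) UNIV_I mem_Collect_eq)
  ultimately show ?thesis unfolding Lg_def by blast
qed

text \<open>The left inverse c is absorbed into the coefficients. Hence a perturbed representation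
  of 1 still serves as long as its sum stays left invertible.\<close>

lemma mem_Lg_if_left_invertible:
  assumes "a \<in> {1..n} \<rightarrow>\<^sub>E UNIV" and "c * (\<Sum>i\<in>{1..n}. b i * a i) = 1"
  shows "a \<in> Lg n"
proof -
  have "(\<Sum>i\<in>{1..n}. (c * b i) * a i) = 1"
    using assms(2) by (simp add: sum_distrib_left mult.assoc)
  then have "\<exists>b. (\<Sum>i\<in>{1..n}. b i * a i) = 1"
    by (rule exI[of _ "\<lambda>i. c * b i"])
  then show ?thesis unfolding mem_Lg_iff using assms(1) by blast
qed

section \<open>The topology on tuples and the openness of \<open>Lg n\<close>\<close>

abbreviation tuple_topology :: "nat \<Rightarrow> (nat \<Rightarrow> 'a::topological_space) topology" where
  "tuple_topology n \<equiv> product_topology (\<lambda>_. euclidean) {1..n}"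

text \<open>For e > 0 this is the open ball of the maximum metric on tuples. In a normed space each
  factor is convex, which later keeps segments inside the box.\<close>

abbreviation box_ball :: "nat \<Rightarrow> (nat \<Rightarrow> 'a::metric_space) \<Rightarrow> real \<Rightarrow> (nat \<Rightarrow> 'a) set" where
  "box_ball n a e \<equiv> PiE {1..n} (\<lambda>i. ball (a i) e)"

lemma openin_box_ball: "openin (tuple_topology n) (box_ball n a e)"
  by (simp add: openin_PiE)

text \<open>There are finitely many coordinates, so the radii found for each of them have a common
  positive lower bound.\<close>

lemma openin_tuple_topology_iff:
  "openin (tuple_topology n) S \<longleftrightarrow>
     S \<subseteq> {1..n} \<rightarrow>\<^sub>E UNIV \<and> (\<forall>a\<in>S. \<exists>e>0. box_ball n a e \<subseteq> S)"
proof (intro iffI conjI ballI)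
  assume S: "openin (tuple_topology n) S"
  show "S \<subseteq> {1..n} \<rightarrow>\<^sub>E UNIV"
    using openin_subset[OF S] by simp
  fix a assume "a \<in> S"
  then obtain U where U: "\<And>i. i \<in> {1..n} \<Longrightarrow> open (U i)"
      "a \<in> Pi\<^sub>E {1..n} U" "Pi\<^sub>E {1..n} U \<subseteq> S"
    using S unfolding openin_product_topology_alt by (metis open_openin)
  have "\<exists>e>0. ball (a i) e \<subseteq> U i" if "i \<in> {1..n}" for i
    using U that open_contains_ball by (metis PiE_mem)
  then obtain e where e: "\<And>i. i \<in> {1..n} \<Longrightarrow> e i > 0 \<and> ball (a i) (e i) \<subseteq> U i"
    by metis
  \<comment> \<open>The additional element 1 keeps the minimum meaningful when n = 0.\<close>
  define d where "d = Min (insert 1 (e ` {1..n}))"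
  have "d > 0" unfolding d_def using e by (subst Min_gr_iff) auto
  moreover have "d \<le> e i" if "i \<in> {1..n}" for i
    unfolding d_def using that by (intro Min_le) auto
  then have "box_ball n a d \<subseteq> Pi\<^sub>E {1..n} U"
    using e by (intro PiE_mono) (meson order_trans subset_ball)
  ultimately show "\<exists>e>0. box_ball n a e \<subseteq> S" using U(3) by blast
next
  assume S: "S \<subseteq> {1..n} \<rightarrow>\<^sub>E UNIV \<and> (\<forall>a\<in>S. \<exists>e>0. box_ball n a e \<subseteq> S)"
  show "openin (tuple_topology n) S"
  proof (subst openin_subopen, intro ballI)
    fix a assume "a \<in> S"
    then obtain e where e: "e > 0" "box_ball n a e \<subseteq> S" using S by blast
    moreover have "a \<in> {1..n} \<rightarrow>\<^sub>E UNIV" using S \<open>a \<in> S\<close> by blast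
    ultimately have "a \<in> box_ball n a e" by (simp add: PiE_iff)
    then show "\<exists>T. openin (tuple_topology n) T \<and> a \<in> T \<and> T \<subseteq> S"
      using e(2) openin_box_ball by (intro exI[of _ "box_ball n a e"] conjI)
  qed
qed

text \<open>With c a sum of norms, this e is a perturbation size that keeps a sum representing 1 at
  distance less than 1 from the unit.\<close>

lemma exists_pos_mult_less_one:
  fixes c :: real
  assumes "c \<ge> 0"
  shows "\<exists>e>0. e * c < 1"
  using assms by (intro exI[of _ "1 / (1 + c)"]) (simp add: field_simps)

text \<open>The coefficients that represent 1 over a are kept for x near a: the resulting sum is
  within distance less than 1 of the unit, hence left invertible.\<close>

lemma openin_Lg: "openin (tuple_topology n) (Lg n :: (nat \<Rightarrow> 'a::complex_banach_algebra) set)"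
  unfolding openin_tuple_topology_iff
proof (intro conjI ballI)
  show "(Lg n :: (nat \<Rightarrow> 'a) set) \<subseteq> {1..n} \<rightarrow>\<^sub>E UNIV"
    using mem_Lg_iff by blast
  fix a :: "nat \<Rightarrow> 'a" assume "a \<in> Lg n"
  then obtain b where b: "(\<Sum>i\<in>{1..n}. b i * a i) = 1" by (auto simp: mem_Lg_iff)
  obtain e where e: "e > 0" "e * (\<Sum>i\<in>{1..n}. norm (b i)) < 1"
    using exists_pos_mult_less_one[of "\<Sum>i\<in>{1..n}. norm (b i)"] by (auto simp: sum_nonneg)
  have "box_ball n a e \<subseteq> Lg n"
  proof
    fix x assume x: "x \<in> box_ball n a e"
    have "norm (\<Sum>i\<in>{1..n}. b i * (x i - a i)) \<le> (\<Sum>i\<in>{1..n}. norm (b i) * e)"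
    proof (rule sum_norm_le)
      fix i assume "i \<in> {1..n}"
      then have "norm (x i - a i) \<le> e"
        using x by (force simp: PiE_iff dist_norm norm_minus_commute)
      then show "norm (b i * (x i - a i)) \<le> norm (b i) * e"
        by (meson mult_left_mono norm_ge_zero norm_mult_ineq order_trans)
    qed
    also have "\<dots> < 1" using e(2) by (simp add: sum_distrib_left mult.commute)
    finally have "norm ((\<Sum>i\<in>{1..n}. b i * x i) - 1) < 1"
      by (simp add: right_diff_distrib sum_subtractf b[simplified])
    then obtain c where "c * (\<Sum>i\<in>{1..n}. b i * x i) = 1"
      using left_inverse_near_one by blast
    moreover have "x \<in> {1..n} \<rightarrow>\<^sub>E UNIV" using x by (simp add: PiE_iff)
    ultimately show "x \<in> Lg n" by (intro mem_Lg_if_left_invertible)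
  qed
  with e(1) show "\<exists>e>0. box_ball n a e \<subseteq> Lg n" by blast
qed

lemma connected_Lg_iff:
  "connected_Lg TYPE('a::complex_banach_algebra) n \<longleftrightarrow>
     \<not> (\<exists>U V. openin (tuple_topology n) U \<and> openin (tuple_topology n) V \<and>
       (Lg n :: (nat \<Rightarrow> 'a) set) \<subseteq> U \<union> V \<and> U \<inter> V \<inter> Lg n = {} \<and>
       U \<inter> Lg n \<noteq> {} \<and> V \<inter> Lg n \<noteq> {})"
  by (simp only: connected_Lg_def connectedin openin_subset[OF openin_Lg] simp_thms)

lemma connectedin_tuple_segment:
  fixes x y :: "nat \<Rightarrow> 'a::real_normed_vector"
  shows "connectedin (tuple_topology n)
           ((\<lambda>t. \<lambda>i\<in>{1..n}. (1 - t) *\<^sub>R x i + t *\<^sub>R y i) ` {0..1})"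
proof (rule connectedin_continuous_map_image)
  show "continuous_map euclideanreal (tuple_topology n)
          (\<lambda>t. \<lambda>i\<in>{1..n}. (1 - t) *\<^sub>R x i + t *\<^sub>R y i)"
    by (auto simp: continuous_map_componentwise intro!: continuous_intros)
qed simp

section \<open>The morphism on tuples: density and lifting of left invertibility\<close>

text \<open>Relative spectrality only asserts that a suitable X exists; the locale fixes one, so
  that all lemmas refer to the same dense subalgebra.\<close>

locale dense_relatively_spectral =
  fixes \<phi> :: "'a::complex_banach_algebra \<Rightarrow> 'b::complex_banach_algebra" and X :: "'a set"
  assumes dense_morphism: "dense_morphism \<phi>"
    and subalgebra: "subalgebra X"
    and closure_X: "closure X = UNIV"
    and spectrum_eq: "x \<in> X \<Longrightarrow> spectrum (\<phi> x) = spectrum x"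
begin

lemma hom_add: "\<phi> (x + y) = \<phi> x + \<phi> y"
  and hom_mult: "\<phi> (x * y) = \<phi> x * \<phi> y"
  and hom_one: "\<phi> 1 = 1"
  and hom_scaleC: "\<phi> (c *\<^sub>C x) = c *\<^sub>C \<phi> x"
  and continuous_hom: "continuous_on UNIV \<phi>"
  using dense_morphism by (auto simp: dense_morphism_def morphism_def)

lemma hom_scaleR: "\<phi> (r *\<^sub>R x) = r *\<^sub>R \<phi> x"
  by (metis hom_scaleC scaleC_of_real)

lemma hom_zero: "\<phi> 0 = 0"
  using hom_add[of 0 0] by simp

lemma hom_sum: "\<phi> (sum f I) = (\<Sum>i\<in>I. \<phi> (f i))"
  by (induction I rule: infinite_finite_induct) (auto simp: hom_zero hom_add)

lemma X_scaleR: "x \<in> X \<Longrightarrow> r *\<^sub>R x \<in> X"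
  using subalgebra unfolding subalgebra_def by (metis scaleC_of_real)

lemma X_add: "x \<in> X \<Longrightarrow> y \<in> X \<Longrightarrow> x + y \<in> X"
  and X_mult: "x \<in> X \<Longrightarrow> y \<in> X \<Longrightarrow> x * y \<in> X"
  using subalgebra by (auto simp: subalgebra_def)

lemma X_zero: "0 \<in> X"
  using subalgebra X_scaleR[of 1 0] by (simp add: subalgebra_def)

lemma X_sum: "(\<And>i. i \<in> I \<Longrightarrow> f i \<in> X) \<Longrightarrow> sum f I \<in> X"
  by (induction I rule: infinite_finite_induct) (auto simp: X_zero X_add)

lemma X_approx:
  assumes "e > 0"
  shows "\<exists>x\<in>X. dist (\<phi> x) b < e"
proof -
  have "range \<phi> \<subseteq> closure (\<phi> ` X)"
    using image_closure_subset[of X \<phi> "closure (\<phi> ` X)"] continuous_hom closure_X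
    by (auto simp: closure_subset)
  then have "closure (range \<phi>) \<subseteq> closure (\<phi> ` X)"
    by (simp add: closure_minimal)
  then have "b \<in> closure (\<phi> ` X)"
    using dense_morphism by (auto simp: dense_morphism_def)
  then show ?thesis using assms by (auto simp: closure_approachable)
qed

lemma X_approx_family:
  assumes "e > 0"
  shows "\<exists>y. (\<forall>i. y i \<in> X) \<and> (\<forall>i. dist (\<phi> (y i)) (b i) < e)"
proof -
  have "\<forall>i. \<exists>x. x \<in> X \<and> dist (\<phi> x) (b i) < e"
    using X_approx[OF assms] by blast
  from choice[OF this] show ?thesis by blast
qed

text \<open>The restriction resets entries outside {1..n} to \<open>undefined\<close>, a value that
  \<open>\<phi>\<close> need not preserve.\<close>

definition tuple_hom :: "nat \<Rightarrow> (nat \<Rightarrow> 'a) \<Rightarrow> (nat \<Rightarrow> 'b)" where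
  "tuple_hom n x = (\<lambda>i\<in>{1..n}. \<phi> (x i))"

lemma continuous_map_tuple_hom:
  "continuous_map (tuple_topology n) (tuple_topology n) (tuple_hom n)"
proof -
  have "continuous_map (tuple_topology n) euclidean (\<lambda>x. \<phi> (x i))" if "i \<in> {1..n}" for i
  proof -
    have "continuous_map (tuple_topology n) euclidean (\<phi> \<circ> (\<lambda>x. x i))"
      using that continuous_hom
      by (intro continuous_map_compose[OF continuous_map_product_projection]) auto
    then show ?thesis by (simp add: o_def)
  qed
  then show ?thesis
    unfolding tuple_hom_def by (auto simp: continuous_map_componentwise)
qed

lemma tuple_hom_mem_Lg:
  assumes "x \<in> Lg n"
  shows "tuple_hom n x \<in> Lg n"
proof -
  obtain b where "(\<Sum>i\<in>{1..n}. b i * x i) = 1" using assms by (auto simp: mem_Lg_iff)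
  then have "(\<Sum>i\<in>{1..n}. \<phi> (b i) * \<phi> (x i)) = 1"
    by (metis (no_types, lifting) hom_mult hom_one hom_sum sum.cong)
  then have "(\<Sum>i\<in>{1..n}. \<phi> (b i) * tuple_hom n x i) = 1"
    by (simp add: tuple_hom_def)
  then show ?thesis unfolding mem_Lg_iff by (auto simp: tuple_hom_def)
qed

text \<open>This is where equality of spectra enters: it carries invertibility of a single element
  back from B to A, and the tuple is reduced to the single element s.\<close>

lemma mem_Lg_if_tuple_hom_mem_Lg:
  assumes x: "x \<in> {1..n} \<rightarrow>\<^sub>E X" and "tuple_hom n x \<in> Lg n"
  shows "x \<in> Lg n"
proof -
  obtain b where "(\<Sum>i\<in>{1..n}. b i * tuple_hom n x i) = 1"
    using assms(2) by (auto simp: mem_Lg_iff)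
  then have b: "(\<Sum>i\<in>{1..n}. b i * \<phi> (x i)) = 1" by (simp add: tuple_hom_def)
  \<comment> \<open>This e bounds the total error below 1 when each \<open>b i\<close> is replaced
    by a nearby \<open>\<phi> (y i)\<close>.\<close>
  obtain e where e: "e > 0" "e * (\<Sum>i\<in>{1..n}. norm (\<phi> (x i))) < 1"
    using exists_pos_mult_less_one[of "\<Sum>i\<in>{1..n}. norm (\<phi> (x i))"] by (auto simp: sum_nonneg)
  obtain y where y: "\<And>i. y i \<in> X" "\<And>i. dist (\<phi> (y i)) (b i) < e"
    using X_approx_family[OF e(1)] by metis
  define s where "s = (\<Sum>i\<in>{1..n}. y i * x i)"
  have "norm (\<Sum>i\<in>{1..n}. (\<phi> (y i) - b i) * \<phi> (x i)) \<le> (\<Sum>i\<in>{1..n}. e * norm (\<phi> (x i)))"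
  proof (rule sum_norm_le)
    fix i
    have "norm (\<phi> (y i) - b i) \<le> e" using y(2)[of i] by (simp add: dist_norm)
    then show "norm ((\<phi> (y i) - b i) * \<phi> (x i)) \<le> e * norm (\<phi> (x i))"
      by (meson mult_right_mono norm_ge_zero norm_mult_ineq order_trans)
  qed
  also have "\<dots> < 1" using e(2) by (simp add: sum_distrib_left)
  finally have "norm (\<phi> s - 1) < 1"
    by (simp add: s_def hom_sum hom_mult left_diff_distrib sum_subtractf b[simplified])
  then have "0 \<notin> spectrum (\<phi> s)"
    using inverse_near_one zero_notin_spectrum_iff by blast
  \<comment> \<open>Both the coefficients y and the entries of x lie in X, so equality of spectra
    applies to s.\<close>
  moreover have "s \<in> X"
    unfolding s_def using x y(1) by (intro X_sum X_mult) auto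
  ultimately obtain c where "c * s = 1"
    using spectrum_eq zero_notin_spectrum_iff by metis
  then show ?thesis
    using mem_Lg_if_left_invertible[of x n c y] x by (auto simp: s_def PiE_iff)
qed

lemma tuple_hom_approx:
  assumes "e > 0"
  shows "\<exists>x \<in> {1..n} \<rightarrow>\<^sub>E X. tuple_hom n x \<in> box_ball n b e"
proof -
  obtain y where "\<And>i. y i \<in> X" "\<And>i. dist (\<phi> (y i)) (b i) < e"
    using X_approx_family[OF assms] by metis
  then show ?thesis
    by (intro bexI[of _ "\<lambda>i\<in>{1..n}. y i"]) (auto simp: tuple_hom_def dist_commute)
qed

lemma tuple_hom_dense:
  assumes "openin (tuple_topology n) W" and "W \<noteq> {}"
  shows "\<exists>x \<in> {1..n} \<rightarrow>\<^sub>E X. tuple_hom n x \<in> W"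
proof -
  obtain b e where "e > 0" "box_ball n b e \<subseteq> W"
    using assms unfolding openin_tuple_topology_iff by blast
  then show ?thesis using tuple_hom_approx[of e n b] by (meson subsetD)
qed

section \<open>Connectedness passes from A to B\<close>

text \<open>A set between a connected set and its closure is connected. Here the connected set is
  the image of \<open>Lg n\<close> over A, and \<open>Lg n\<close> over B lies in its
  closure.\<close>

lemma connected_Lg_hom:
  assumes "connected_Lg TYPE('a) n"
  shows "connected_Lg TYPE('b) n"
  unfolding connected_Lg_def
proof (rule connectedin_intermediate_closure_of)
  show "connectedin (tuple_topology n) (tuple_hom n ` Lg n)"
    using assms connectedin_continuous_map_image[OF continuous_map_tuple_hom]
    unfolding connected_Lg_def by blast
  show "tuple_hom n ` Lg n \<subseteq> Lg n" using tuple_hom_mem_Lg by blast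
  show "Lg n \<subseteq> tuple_topology n closure_of (tuple_hom n ` Lg n)"
  proof
    fix b :: "nat \<Rightarrow> 'b" assume b: "b \<in> Lg n"
    have "\<exists>y\<in>tuple_hom n ` Lg n. y \<in> T" if T: "b \<in> T" "openin (tuple_topology n) T" for T
    proof -
      \<comment> \<open>Since \<open>Lg n\<close> is open, T can be shrunk into it; the
        approximating image then lies in \<open>Lg n\<close> over B, so its preimage over X lies in
        \<open>Lg n\<close> over A.\<close>
      have "openin (tuple_topology n) (T \<inter> Lg n)" using T(2) openin_Lg by blast
      then obtain x where "x \<in> {1..n} \<rightarrow>\<^sub>E X" "tuple_hom n x \<in> T \<inter> Lg n"
        using tuple_hom_dense T(1) b by (metis IntI empty_iff)
      then show ?thesis using mem_Lg_if_tuple_hom_mem_Lg[of x n] by blast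
    qed
    then show "b \<in> tuple_topology n closure_of (tuple_hom n ` Lg n)"
      using b by (auto simp: in_closure_of mem_Lg_iff)
  qed
qed

section \<open>Connectedness passes from B to A\<close>

text \<open>The segment from x to y has entries in X, and its image stays in the convex box. Left
  invertibility therefore lifts at each of its points, and no separation of \<open>Lg n\<close> over
  A can split x from y.\<close>

lemma connected_preimage_of_box:
  assumes x: "x \<in> {1..n} \<rightarrow>\<^sub>E X" "tuple_hom n x \<in> box_ball n b e"
    and y: "y \<in> {1..n} \<rightarrow>\<^sub>E X" "tuple_hom n y \<in> box_ball n b e"
    and box: "box_ball n b e \<subseteq> Lg n"
  shows "\<exists>C. connectedin (tuple_topology n) C \<and> x \<in> C \<and> y \<in> C \<and> C \<subseteq> Lg n"
proof -
  define \<gamma> where "\<gamma> = (\<lambda>t. \<lambda>i\<in>{1..n}. (1 - t) *\<^sub>R x i + t *\<^sub>R y i)"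
  have "\<gamma> t \<in> Lg n" if t: "t \<in> {0..1}" for t
  proof (rule mem_Lg_if_tuple_hom_mem_Lg)
    show "\<gamma> t \<in> {1..n} \<rightarrow>\<^sub>E X"
      unfolding \<gamma>_def using x(1) y(1) by (intro restrict_PiE_iff[THEN iffD2] ballI X_add X_scaleR) auto
    have "(1 - t) *\<^sub>R \<phi> (x i) + t *\<^sub>R \<phi> (y i) \<in> ball (b i) e" if i: "i \<in> {1..n}" for i
    proof (rule convexD)
      show "\<phi> (x i) \<in> ball (b i) e" "\<phi> (y i) \<in> ball (b i) e"
        using PiE_mem[OF x(2) i] PiE_mem[OF y(2) i] i by (auto simp: tuple_hom_def)
    qed (use t in auto)
    then have "tuple_hom n (\<gamma> t) \<in> box_ball n b e"
      by (auto simp: tuple_hom_def \<gamma>_def hom_add hom_scaleR)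
    then show "tuple_hom n (\<gamma> t) \<in> Lg n" using box by blast
  qed
  \<comment> \<open>Since x and y are extensional, the end points agree with them outside {1..n}
    too.\<close>
  moreover have "\<gamma> 0 = x" "\<gamma> 1 = y"
    using x(1) y(1) by (auto simp: \<gamma>_def fun_eq_iff PiE_def extensional_def)
  then have "x \<in> \<gamma> ` {0..1}" "y \<in> \<gamma> ` {0..1}"
    by (metis atLeastAtMost_iff image_eqI order_refl zero_le_one)+
  moreover have "connectedin (tuple_topology n) (\<gamma> ` {0..1})"
    unfolding \<gamma>_def by (rule connectedin_tuple_segment)
  ultimately show ?thesis by blast
qed

definition transported :: "nat \<Rightarrow> (nat \<Rightarrow> 'a) set \<Rightarrow> (nat \<Rightarrow> 'b) set" where
  "transported n U = \<Union>{box_ball n b e | b e. box_ball n b e \<subseteq> Lg n \<and>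
     (\<forall>x \<in> {1..n} \<rightarrow>\<^sub>E X. tuple_hom n x \<in> box_ball n b e \<longrightarrow> x \<in> U)}"

lemma transportedI:
  assumes "box_ball n b e \<subseteq> Lg n"
    and "\<forall>x \<in> {1..n} \<rightarrow>\<^sub>E X. tuple_hom n x \<in> box_ball n b e \<longrightarrow> x \<in> U"
    and "c \<in> box_ball n b e"
  shows "c \<in> transported n U"
  unfolding transported_def using assms by (intro UnionI[of "box_ball n b e"] CollectI exI conjI) auto

lemma openin_transported: "openin (tuple_topology n) (transported n U)"
  unfolding transported_def using openin_box_ball by (intro openin_Union) blast

text \<open>A nonempty intersection would be open and so contain the image of a tuple over X. That
  tuple would lie in U, in V and, by lifting, in \<open>Lg n\<close>.\<close>

lemma transported_disjoint:
  assumes "U \<inter> V \<inter> Lg n = {}"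
  shows "transported n U \<inter> transported n V = {}"
proof (rule ccontr)
  assume "transported n U \<inter> transported n V \<noteq> {}"
  then obtain x where x: "x \<in> {1..n} \<rightarrow>\<^sub>E X" "tuple_hom n x \<in> transported n U \<inter> transported n V"
    using tuple_hom_dense openin_transported by (metis openin_Int)
  then have "x \<in> U \<inter> V" "tuple_hom n x \<in> Lg n" by (auto simp: transported_def)
  then show False using assms mem_Lg_if_tuple_hom_mem_Lg[OF x(1)] by blast
qed

text \<open>The image lies in \<open>Lg n\<close> over B, so x lies in \<open>Lg n\<close> over A
  and hence not in V. This excludes the set transported from V.\<close>

lemma tuple_hom_mem_transported:
  assumes "x \<in> {1..n} \<rightarrow>\<^sub>E X" "x \<in> U"
    and "tuple_hom n x \<in> transported n U \<union> transported n V" and "U \<inter> V \<inter> Lg n = {}"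
  shows "tuple_hom n x \<in> transported n U"
proof -
  have "x \<notin> V"
    using assms(1,2,3,4) mem_Lg_if_tuple_hom_mem_Lg[OF assms(1)]
    by (auto simp: transported_def)
  then show ?thesis using assms(1,3) by (auto simp: transported_def)
qed

text \<open>Around b there is a box inside \<open>Lg n\<close>. Any two tuples over X landing in it
  are joined by a connected set in \<open>Lg n\<close> over A, so all of them are on the same side
  of the separation.\<close>

lemma Lg_subset_transported:
  assumes U: "openin (tuple_topology n) U" and V: "openin (tuple_topology n) V"
    and UV: "Lg n \<subseteq> U \<union> V" "U \<inter> V \<inter> Lg n = {}"
  shows "Lg n \<subseteq> transported n U \<union> transported n V"
proof
  fix b :: "nat \<Rightarrow> 'b" assume b: "b \<in> Lg n"
  then obtain e where e: "e > 0" "box_ball n b e \<subseteq> Lg n"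
    using openin_Lg unfolding openin_tuple_topology_iff by blast
  have bb: "b \<in> box_ball n b e" using b e(1) by (auto simp: mem_Lg_iff PiE_iff)
  have Lg: "x \<in> Lg n" if "x \<in> {1..n} \<rightarrow>\<^sub>E X" "tuple_hom n x \<in> box_ball n b e" for x
    using that e(2) mem_Lg_if_tuple_hom_mem_Lg by blast
  have "(\<forall>x \<in> {1..n} \<rightarrow>\<^sub>E X. tuple_hom n x \<in> box_ball n b e \<longrightarrow> x \<in> U) \<or>
        (\<forall>x \<in> {1..n} \<rightarrow>\<^sub>E X. tuple_hom n x \<in> box_ball n b e \<longrightarrow> x \<in> V)"
  proof (rule ccontr)
    assume "\<not> ?thesis"
    then obtain x y where
      xy: "x \<in> {1..n} \<rightarrow>\<^sub>E X" "tuple_hom n x \<in> box_ball n b e" "x \<notin> U"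
          "y \<in> {1..n} \<rightarrow>\<^sub>E X" "tuple_hom n y \<in> box_ball n b e" "y \<notin> V" by blast
    obtain C where C: "connectedin (tuple_topology n) C" "x \<in> C" "y \<in> C" "C \<subseteq> Lg n"
      using connected_preimage_of_box[OF xy(1,2) xy(4,5) e(2)] by blast
    \<comment> \<open>The cover places x, which misses U, in V, and likewise y in U; so U and V
      would separate C.\<close>
    have "x \<in> V" "y \<in> U" using xy Lg UV(1) by blast+
    then have "U \<inter> C \<noteq> {}" "V \<inter> C \<noteq> {}" "C \<subseteq> U \<union> V" "U \<inter> V \<inter> C = {}"
      using C UV by blast+
    then show False using C(1) U V unfolding connectedin by blast
  qed
  then show "b \<in> transported n U \<union> transported n V"
    using transportedI[OF e(2) _ bb] by (meson UnI1 UnI2)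
qed

text \<open>Density of X in A gives a tuple over X in the open set \<open>U \<inter> Lg n\<close>.
  Its image is covered, and it falls on the side of U.\<close>

lemma transported_nonempty:
  assumes U: "openin (tuple_topology n) U" "U \<inter> Lg n \<noteq> {}"
    and cover: "Lg n \<subseteq> transported n U \<union> transported n V" and "U \<inter> V \<inter> Lg n = {}"
  shows "transported n U \<inter> Lg n \<noteq> {}"
proof -
  have "openin (tuple_topology n) (U \<inter> Lg n)" using U(1) openin_Lg by blast
  then obtain a e where a: "a \<in> U \<inter> Lg n" "e > 0" "box_ball n a e \<subseteq> U \<inter> Lg n"
    using U(2) unfolding openin_tuple_topology_iff by blast
  have "\<exists>x\<in>X. dist x (a i) < e" for i
    using closure_X a(2) closure_approachable[of "a i" X] by auto
  then obtain y where "\<And>i. y i \<in> X" "\<And>i. dist (y i) (a i) < e" by metis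
  then have x: "(\<lambda>i\<in>{1..n}. y i) \<in> {1..n} \<rightarrow>\<^sub>E X" "(\<lambda>i\<in>{1..n}. y i) \<in> box_ball n a e"
    by (auto simp: dist_commute)
  then have "(\<lambda>i\<in>{1..n}. y i) \<in> U" "tuple_hom n (\<lambda>i\<in>{1..n}. y i) \<in> Lg n"
    using a(3) tuple_hom_mem_Lg by blast+
  then show ?thesis
    using tuple_hom_mem_transported[OF x(1), of U V] cover assms(4) by blast
qed

lemma connected_Lg_hom_reverse:
  assumes "connected_Lg TYPE('b) n"
  shows "connected_Lg TYPE('a) n"
proof (rule ccontr)
  assume "\<not> connected_Lg TYPE('a) n"
  then obtain U V :: "(nat \<Rightarrow> 'a) set" where UV:
    "openin (tuple_topology n) U" "openin (tuple_topology n) V" "Lg n \<subseteq> U \<union> V"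
    "U \<inter> V \<inter> Lg n = {}" "U \<inter> Lg n \<noteq> {}" "V \<inter> Lg n \<noteq> {}"
    unfolding connected_Lg_iff not_not by blast
  note cover = Lg_subset_transported[OF UV(1-4)]
  have "transported n U \<inter> Lg n \<noteq> {}"
    by (rule transported_nonempty[OF UV(1,5) cover UV(4)])
  moreover have "transported n V \<inter> Lg n \<noteq> {}"
    by (rule transported_nonempty[where V = U]) (use UV cover in \<open>auto simp: Int_commute\<close>)
  moreover have "transported n U \<inter> transported n V = {}"
    using transported_disjoint UV(4) .
  ultimately show False
    using assms cover openin_transported[of n U] openin_transported[of n V]
    unfolding connected_Lg_iff by (metis Int_empty_left)
qed

end

theorem theorem1p3:
  fixes \<phi> :: "'a::complex_banach_algebra \<Rightarrow> 'b::complex_banach_algebra"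
  assumes "dense_morphism \<phi>" and "relatively_spectral \<phi>"
  shows "csr TYPE('a) = csr TYPE('b)"
proof -
  obtain X where "subalgebra X" "closure X = UNIV" "\<And>x. x \<in> X \<Longrightarrow> spectrum (\<phi> x) = spectrum x"
    using assms(2) unfolding relatively_spectral_def by blast
  then interpret dense_relatively_spectral \<phi> X
    using assms(1) by unfold_locales
  \<comment> \<open>The stable rank depends on the algebra only through the set of n with
    \<open>Lg n\<close> connected, so equivalence for each n settles the finite and the infinite
    case together.\<close>
  have "connected_Lg TYPE('a) n \<longleftrightarrow> connected_Lg TYPE('b) n" for n
    using connected_Lg_hom connected_Lg_hom_reverse by blast
  then show ?thesis by (simp add: csr_def)
qed

end
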